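(* Let $\Delta$ be a shellable simplicial complex on the finite vertex set $S$. (i) Let $P=(S,\leq_P)$ be a partial order on $S$. Then the Boolean cell complex $\Gamma(\Delta,P)$ is shellable. (ii) Let $G=(S,E)$ be a simple graph on $S$. Then the Boolean cell complex $\Gamma/G(\Delta)$ is shellable.
   Context: All complexes are finite. A simplicial complex on $S$ is a family of subsets of $S$ containing $\emptyset$ and closed under taking subsets. A Boolean cell complex is a regular CW-complex for which the poset of faces of each cell (including the empty face) is a Boolean lattice; it is identified with its face poset (including the empty face). Simplicial complexes are special cases. Injective words: an injective word over $S$ is a word $w=\omega_1\cdots\omega_r$ ($r\ge 0$) with pairwise distinct letters in $S$; its content is $c(w)=\{\omega_1,\dots,\omega_r\}$. A subword of $w$ is $\omega_{j_1}\cdots\omega_{j_s}$ with $1\le j_1<\cdots<j_s\le r$; write $v\preceq w$ if $v$ is a subword of $w$. A word of length $d+1$ is regarded as a cell of dimension $d$. $\Gamma(\Delta)$ is the set of injective words $w$ over $S$ with $c(w)\in\Delta$, ordered by $\preceq$. $\Gamma(\Delta,P)$ is the set of all $\omega_1\cdots\omega_r\in\Gamma(\Delta)$ such that $i<j$ whenever $\omega_i<_P\omega_j$, ordered by $\preceq$; it is the face poset of a Boolean cell complex. For a graph $G=(S,E)$ and an injective word $w$, the class $[w]$ is the set of all words obtained from $w$ by a sequence of commutations $ss'\to s's$ of neighboring letters with $\{s,s'\}\notin E$. $\Gamma/G(\Delta)$ is the set of classes $[w]$ with $c(w)\in\Delta$, ordered by $[v]\preceq[w]$ if there are $v'\in[v]$,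 $w'\in[w]$ with $v'\preceq w'$; it is the face poset of a Boolean cell complex. Shellability: a Boolean cell complex is pure if all its inclusion-maximal cells have the same dimension. For a cell $\sigma$ of $\Gamma$, $\mathrm{fdel}_\Gamma(\sigma)$ is the complex obtained by removing $\sigma$ and all cells containing $\sigma$. The class of shellable finite Boolean cell complexes is defined recursively: $\Gamma$ is shellable if either (a) $\Gamma=2^\Omega$ for some finite set $\Omega$ (possibly empty, in which case $\Gamma=\{\emptyset\}$), or (b) $\Gamma$ is pure and there is a cell $\sigma$ of $\Gamma$ contained in a unique maximal cell $\tau$ ($\sigma=\tau$ allowed) such that $\mathrm{fdel}_\Gamma(\sigma)$ is shellable. *)

theory Defs
  imports Main "HOL-Library.Sublist"
begin

definition simplicial_complex :: "'a set \<Rightarrow> 'a set set \<Rightarrow> bool" where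
  "simplicial_complex S \<Delta> \<longleftrightarrow>
     \<Delta> \<subseteq> Pow S \<and> {} \<in> \<Delta> \<and> (\<forall>\<sigma>\<in>\<Delta>. \<forall>\<rho>. \<rho> \<subseteq> \<sigma> \<longrightarrow> \<rho> \<in> \<Delta>)"

text \<open>A Boolean cell complex is represented by its face poset (including the empty face):
  a set \<open>\<Gamma>\<close> of cells together with a relation \<open>le\<close> that orders \<open>\<Gamma>\<close>; the values of
  \<open>le\<close> outside \<open>\<Gamma>\<close> are irrelevant.\<close>

definition iso_Pow :: "('c \<Rightarrow> 'c \<Rightarrow> bool) \<Rightarrow> 'c set \<Rightarrow> 'v set \<Rightarrow> bool" where
  "iso_Pow le A \<Omega> \<longleftrightarrow>
     (\<exists>f. bij_betw f A (Pow \<Omega>) \<and> (\<forall>x\<in>A. \<forall>y\<in>A. le x y \<longleftrightarrow> f x \<subseteq> f y))"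

definition faces :: "('c \<Rightarrow> 'c \<Rightarrow> bool) \<Rightarrow> 'c set \<Rightarrow> 'c \<Rightarrow> 'c set" where
  "faces le \<Gamma> \<sigma> = {\<rho> \<in> \<Gamma>. le \<rho> \<sigma>}"

text \<open>Finite posets with a least element in which all lower intervals are Boolean lattices are
  precisely the face posets of finite Boolean cell complexes (regular CW-complexes in which
  the faces of each cell form a Boolean lattice). Up to bijection every finite set is
  a set of natural numbers, so ranging over \<open>\<Omega> :: nat set\<close> is no restriction.\<close>

definition boolean_complex :: "('c \<Rightarrow> 'c \<Rightarrow> bool) \<Rightarrow> 'c set \<Rightarrow> bool" where
  "boolean_complex le \<Gamma> \<longleftrightarrow>
     finite \<Gamma> \<and> reflp_on \<Gamma> le \<and> antisymp_on \<Gamma> le \<and> transp_on \<Gamma> le \<and>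
     (\<exists>\<epsilon>\<in>\<Gamma>. \<forall>\<sigma>\<in>\<Gamma>. le \<epsilon> \<sigma>) \<and>
     (\<forall>\<sigma>\<in>\<Gamma>. \<exists>\<Omega> :: nat set. finite \<Omega> \<and> iso_Pow le (faces le \<Gamma> \<sigma>) \<Omega>)"

text \<open>A cell whose face poset is the Boolean lattice on \<open>d + 1\<close> vertices has dimension \<open>d\<close>;
  the empty face has dimension \<open>-1\<close>. Only meaningful for cells of a Boolean cell complex.\<close>

definition cell_dim :: "('c \<Rightarrow> 'c \<Rightarrow> bool) \<Rightarrow> 'c set \<Rightarrow> 'c \<Rightarrow> int" where
  "cell_dim le \<Gamma> \<sigma> =
     (THE d. \<exists>\<Omega> :: nat set. finite \<Omega> \<and> iso_Pow le (faces le \<Gamma> \<sigma>) \<Omega> \<and> int (card \<Omega>) = d + 1)"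

definition maximal_cells :: "('c \<Rightarrow> 'c \<Rightarrow> bool) \<Rightarrow> 'c set \<Rightarrow> 'c set" where
  "maximal_cells le \<Gamma> = {\<tau> \<in> \<Gamma>. \<forall>\<rho>\<in>\<Gamma>. le \<tau> \<rho> \<longrightarrow> \<rho> = \<tau>}"

definition pure :: "('c \<Rightarrow> 'c \<Rightarrow> bool) \<Rightarrow> 'c set \<Rightarrow> bool" where
  "pure le \<Gamma> \<longleftrightarrow>
     (\<forall>\<sigma>\<in>maximal_cells le \<Gamma>. \<forall>\<tau>\<in>maximal_cells le \<Gamma>. cell_dim le \<Gamma> \<sigma> = cell_dim le \<Gamma> \<tau>)"

definition fdel :: "('c \<Rightarrow> 'c \<Rightarrow> bool) \<Rightarrow> 'c set \<Rightarrow> 'c \<Rightarrow> 'c set" where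
  "fdel le \<Gamma> \<sigma> = {\<rho> \<in> \<Gamma>. \<not> le \<sigma> \<rho>}"

text \<open>Since \<open>\<Gamma> = {}\<close> is not shellable, the empty face is never a suitable \<open>\<sigma>\<close> below.\<close>

inductive shellable :: "('c \<Rightarrow> 'c \<Rightarrow> bool) \<Rightarrow> 'c set \<Rightarrow> bool" for le where
  simplex: "finite (\<Omega> :: nat set) \<Longrightarrow> iso_Pow le \<Gamma> \<Omega> \<Longrightarrow> shellable le \<Gamma>"
| delete: "boolean_complex le \<Gamma> \<Longrightarrow> pure le \<Gamma> \<Longrightarrow> \<sigma> \<in> \<Gamma> \<Longrightarrow>
     \<exists>!\<tau>. \<tau> \<in> maximal_cells le \<Gamma> \<and> le \<sigma> \<tau> \<Longrightarrow>
     shellable le (fdel le \<Gamma> \<sigma>) \<Longrightarrow> shellable le \<Gamma>"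

text \<open>Words are lists; a word is injective iff it is \<^const>\<open>distinct\<close>, its content is
  \<^const>\<open>set\<close>, and the subword order is \<^const>\<open>subseq\<close>. For a complex on \<open>S\<close> the words below are
  automatically words over \<open>S\<close>.\<close>

definition inj_words :: "'a set set \<Rightarrow> 'a list set" where
  "inj_words \<Delta> = {w. distinct w \<and> set w \<in> \<Delta>}"

definition poset_words :: "'a set set \<Rightarrow> 'a rel \<Rightarrow> 'a list set" where
  "poset_words \<Delta> P = {w \<in> inj_words \<Delta>.
     \<forall>i<length w. \<forall>j<length w. (w ! i, w ! j) \<in> P \<and> w ! i \<noteq> w ! j \<longrightarrow> i < j}"

definition simple_graph :: "'a set \<Rightarrow> 'a set set \<Rightarrow> bool" where
  "simple_graph S E \<longleftrightarrow> (\<forall>e\<in>E. e \<subseteq> S \<and> card e = 2)"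

definition commutations :: "'a set set \<Rightarrow> 'a list rel" where
  "commutations E = {(u @ [s, s'] @ v, u @ [s', s] @ v) | u s s' v. {s, s'} \<notin> E}"

definition comm_class :: "'a set set \<Rightarrow> 'a list \<Rightarrow> 'a list set" where
  "comm_class E w = (commutations E)\<^sup>* `` {w}"

definition comm_classes :: "'a set set \<Rightarrow> 'a set set \<Rightarrow> 'a list set set" where
  "comm_classes \<Delta> E = comm_class E ` inj_words \<Delta>"

definition class_le :: "'a list set \<Rightarrow> 'a list set \<Rightarrow> bool" where
  "class_le X Y \<longleftrightarrow> (\<exists>v\<in>X. \<exists>w\<in>Y. subseq v w)"

end

theory Submission
  imports Defs "HOL-Library.List_Lexorder"
begin

text \<open>Both complexes map to \<open>\<Delta>\<close> by taking contents, and the faces of a cell \<open>w\<close> correspond to the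
  subsets of its content. If a face \<open>\<sigma>\<close> of \<open>\<Delta>\<close> lying in a unique facet \<open>\<tau>\<close> is deleted from \<open>\<Delta>\<close>, the
  cells that disappear upstairs are those with content in \<open>[\<sigma>, \<tau>]\<close>. They are put back by adding the
  cells \<open>w\<close> with content \<open>\<tau>\<close> one at a time in a linear order with the following exchange property:
  any common face \<open>v\<close> of \<open>w\<close> and an earlier cell omits some \<open>x\<close> such that the face of \<open>w\<close> with content
  \<open>\<tau> - {x}\<close> already lies in an earlier cell. With \<open>r\<close> the set of all such \<open>x\<close>, the new cells below \<open>w\<close>
  are then exactly those above the face of \<open>w\<close> with content \<open>\<sigma> \<union> r\<close>. For words, and for classes
  represented by their least words, a lexicographic order has the exchange property.\<close>

section \<open>Boolean lattices and maximal cells\<close>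

lemma iso_Pow_card:
  assumes "iso_Pow le A \<Omega>" "finite \<Omega>"
  shows "card A = 2 ^ card \<Omega>"
  using assms by (metis iso_Pow_def bij_betw_same_card card_Pow)

text \<open>A Boolean lattice on n atoms has 2^n elements, so its size determines n and the
  description in \<open>cell_dim\<close> has a unique solution.\<close>

lemma cell_dim_eq:
  fixes \<Omega> :: "nat set"
  assumes "iso_Pow le (faces le \<Gamma> \<sigma>) \<Omega>" "finite \<Omega>"
  shows "cell_dim le \<Gamma> \<sigma> = int (card \<Omega>) - 1"
  unfolding cell_dim_def
proof (rule the_equality)
  show "\<exists>\<Omega>' :: nat set. finite \<Omega>' \<and> iso_Pow le (faces le \<Gamma> \<sigma>) \<Omega>' \<and>
      int (card \<Omega>') = int (card \<Omega>) - 1 + 1"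
    using assms by auto
next
  fix d
  assume "\<exists>\<Omega>' :: nat set. finite \<Omega>' \<and> iso_Pow le (faces le \<Gamma> \<sigma>) \<Omega>' \<and> int (card \<Omega>') = d + 1"
  then obtain \<Omega>' :: "nat set" where
    "finite \<Omega>'" "iso_Pow le (faces le \<Gamma> \<sigma>) \<Omega>'" "int (card \<Omega>') = d + 1" by blast
  moreover from this assms have "(2::nat) ^ card \<Omega>' = 2 ^ card \<Omega>"
    using iso_Pow_card by metis
  ultimately show "d = int (card \<Omega>) - 1" by simp
qed

lemma iso_Pow_greatest:
  assumes "iso_Pow le \<Gamma> \<Omega>"
  obtains \<tau> where "\<tau> \<in> \<Gamma>" "\<And>\<sigma>. \<sigma> \<in> \<Gamma> \<Longrightarrow> le \<sigma> \<tau>"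
proof -
  obtain f where f: "bij_betw f \<Gamma> (Pow \<Omega>)" "\<forall>x\<in>\<Gamma>. \<forall>y\<in>\<Gamma>. le x y \<longleftrightarrow> f x \<subseteq> f y"
    using assms unfolding iso_Pow_def by blast
  obtain \<tau> where "\<tau> \<in> \<Gamma>" "f \<tau> = \<Omega>"
    using f(1) by (metis Pow_top bij_betw_iff_bijections)
  moreover have "f \<sigma> \<subseteq> \<Omega>" if "\<sigma> \<in> \<Gamma>" for \<sigma>
    using f(1) that by (meson PowD bij_betwE)
  ultimately show ?thesis using that f(2) by blast
qed

text \<open>Purity is explicit in the deletion rule; a simplex is pure because its greatest cell is
  its only maximal one.\<close>

lemma shellable_pure:
  assumes "shellable le \<Gamma>"
  shows "pure le \<Gamma>"
  using assms
proof cases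
  case (simplex \<Omega>)
  then obtain \<tau> where "\<tau> \<in> \<Gamma>" "\<And>\<sigma>. \<sigma> \<in> \<Gamma> \<Longrightarrow> le \<sigma> \<tau>" using iso_Pow_greatest by metis
  then have "maximal_cells le \<Gamma> \<subseteq> {\<tau>}" unfolding maximal_cells_def by auto
  then show ?thesis unfolding pure_def by blast
qed

lemma shellable_nonempty: "shellable le \<Gamma> \<Longrightarrow> \<Gamma> \<noteq> {}"
  by (erule shellable.cases) (use iso_Pow_greatest in fastforce)+

lemma subset_maximal_cell:
  assumes "finite \<Delta>" "A \<in> \<Delta>"
  obtains B where "B \<in> maximal_cells (\<subseteq>) \<Delta>" "A \<subseteq> B"
proof -
  obtain B where "B \<in> \<Delta>" "A \<subseteq> B" "\<forall>C\<in>\<Delta>. B \<subseteq> C \<longrightarrow> B = C"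
    using finite_has_maximal2[OF assms] by metis
  then show ?thesis using that[of B] unfolding maximal_cells_def by auto
qed

section \<open>Complexes with a content map\<close>

text \<open>The content of a cell is its vertex set after projecting to the simplex on \<open>S\<close>; the faces of
  a cell are determined by their contents.\<close>

locale labelled_complex =
  fixes le :: "'c \<Rightarrow> 'c \<Rightarrow> bool" and \<Gamma> :: "'c set" and c :: "'c \<Rightarrow> 'a set" and S :: "'a set"
  assumes finite_cells: "finite \<Gamma>"
    and finite_labels: "finite S"
    and content_subset: "x \<in> \<Gamma> \<Longrightarrow> c x \<subseteq> S"
    and le_refl: "x \<in> \<Gamma> \<Longrightarrow> le x x"
    and le_antisym: "x \<in> \<Gamma> \<Longrightarrow> y \<in> \<Gamma> \<Longrightarrow> le x y \<Longrightarrow> le y x \<Longrightarrow> x = y"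
    and le_trans: "x \<in> \<Gamma> \<Longrightarrow> y \<in> \<Gamma> \<Longrightarrow> z \<in> \<Gamma> \<Longrightarrow> le x y \<Longrightarrow> le y z \<Longrightarrow> le x z"
    and content_mono: "x \<in> \<Gamma> \<Longrightarrow> y \<in> \<Gamma> \<Longrightarrow> le x y \<Longrightarrow> c x \<subseteq> c y"
    and le_of_content: "x \<in> \<Gamma> \<Longrightarrow> y \<in> \<Gamma> \<Longrightarrow> z \<in> \<Gamma> \<Longrightarrow> le x z \<Longrightarrow> le y z \<Longrightarrow> c x \<subseteq> c y \<Longrightarrow> le x y"
    and face_exists: "x \<in> \<Gamma> \<Longrightarrow> A \<subseteq> c x \<Longrightarrow> \<exists>y\<in>\<Gamma>. le y x \<and> c y = A"
    and extension: "x \<in> \<Gamma> \<Longrightarrow> c x \<subseteq> F \<Longrightarrow> F \<subseteq> S \<Longrightarrow> \<exists>y\<in>\<Gamma>. le x y \<and> c y = F"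
    and nonempty: "\<Gamma> \<noteq> {}"
    and least: "x \<in> \<Gamma> \<Longrightarrow> y \<in> \<Gamma> \<Longrightarrow> c x = {} \<Longrightarrow> le x y"
begin

section \<open>Down-closed subcomplexes and their face lattices\<close>

definition down_closed :: "'c set \<Rightarrow> bool" where
  "down_closed D \<longleftrightarrow> D \<subseteq> \<Gamma> \<and> (\<forall>x\<in>D. \<forall>y\<in>\<Gamma>. le y x \<longrightarrow> y \<in> D)"

text \<open>The content map sends the faces of \<open>x\<close> bijectively to the subsets of
  \<open>c x\<close>: faces with equal contents lie below each other, and \<open>face_exists\<close>
  gives surjectivity. The bijection \<open>h\<close> renames labels, since the model lattices live
  on sets of naturals.\<close>

lemma faces_iso_Pow:
  assumes "down_closed D" "x \<in> D"
  obtains \<Omega> :: "nat set"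
  where "finite \<Omega>" "card \<Omega> = card (c x)" "iso_Pow le (faces le D x) \<Omega>"
proof -
  have x: "x \<in> \<Gamma>" and faces: "faces le D x = {y \<in> \<Gamma>. le y x}"
    using assms unfolding down_closed_def faces_def by auto
  have "finite (c x)" using x content_subset finite_labels finite_subset by metis
  then obtain h where h: "bij_betw h (c x) {..<card (c x)}"
    using ex_bij_betw_finite_nat by (metis atLeast0LessThan)
  have "bij_betw c {y \<in> \<Gamma>. le y x} (Pow (c x))"
    unfolding bij_betw_def
  proof
    show "inj_on c {y \<in> \<Gamma>. le y x}"
    proof (rule inj_onI)
      fix y z assume "y \<in> {y \<in> \<Gamma>. le y x}" "z \<in> {y \<in> \<Gamma>. le y x}" "c y = c z"
      then show "y = z"
        using le_of_content[of y z x] le_of_content[of z y x] le_antisym[of y z] x by simp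
    qed
    show "c ` {y \<in> \<Gamma>. le y x} = Pow (c x)"
    proof
      show "c ` {y \<in> \<Gamma>. le y x} \<subseteq> Pow (c x)" using x content_mono by blast
      show "Pow (c x) \<subseteq> c ` {y \<in> \<Gamma>. le y x}" using face_exists[OF x] by blast
    qed
  qed
  moreover have "bij_betw ((`) h) (Pow (c x)) (Pow {..<card (c x)})"
    using h by (simp add: bij_betw_Pow)
  ultimately have "bij_betw ((`) h \<circ> c) {y \<in> \<Gamma>. le y x} (Pow {..<card (c x)})"
    by (rule bij_betw_trans)
  moreover have "le y z \<longleftrightarrow> ((`) h \<circ> c) y \<subseteq> ((`) h \<circ> c) z"
    if "y \<in> {y \<in> \<Gamma>. le y x}" "z \<in> {y \<in> \<Gamma>. le y x}" for y z
  proof -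
    have "le y z \<longleftrightarrow> c y \<subseteq> c z" 
      using that x content_mono[of y z] le_of_content[of y z x] by auto
    moreover have "c y \<subseteq> c x" "c z \<subseteq> c x"
      using that x content_mono[of y x] content_mono[of z x] by auto
    ultimately show ?thesis
      using bij_betw_imp_inj_on[OF h] by (auto simp: inj_on_def subset_iff) blast
  qed
  ultimately have "iso_Pow le (faces le D x) {..<card (c x)}"
    unfolding faces iso_Pow_def by blast
  then show ?thesis using that[of "{..<card (c x)}"] by simp
qed

lemma cell_dim_content:
  assumes "down_closed D" "x \<in> D"
  shows "cell_dim le D x = int (card (c x)) - 1"
  using faces_iso_Pow[OF assms] cell_dim_eq by metis

lemma boolean_complex_down_closed:
  assumes D: "down_closed D" "D \<noteq> {}"
  shows "boolean_complex le D"
  unfolding boolean_complex_def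
proof (intro conjI ballI)
  have sub: "D \<subseteq> \<Gamma>" using D unfolding down_closed_def by simp
  show "finite D" using sub finite_cells finite_subset by blast
  show "reflp_on D le" using sub le_refl unfolding reflp_on_def by blast
  show "antisymp_on D le" using sub le_antisym unfolding antisymp_on_def by blast
  show "transp_on D le" using sub le_trans unfolding transp_on_def by blast
  obtain x where x: "x \<in> D" using D by blast
  then obtain e where "e \<in> \<Gamma>" "le e x" "c e = {}" using face_exists sub by blast
  then have "e \<in> D" "\<forall>\<sigma>\<in>D. le e \<sigma>" using D x sub least unfolding down_closed_def by blast+
  then show "\<exists>\<epsilon>\<in>D. \<forall>\<sigma>\<in>D. le \<epsilon> \<sigma>" by blast
  show "\<exists>\<Omega> :: nat set. finite \<Omega> \<and> iso_Pow le (faces le D \<sigma>) \<Omega>" if "\<sigma> \<in> D" for \<sigma>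
    using faces_iso_Pow[OF D(1) that] by metis
qed

text \<open>In the applications \<Gamma> lies over the full simplex \<open>Pow S\<close>, so that
  \<open>extension\<close> holds, and \<open>cells_below \<Delta> {}\<close> cuts out the complex
  over \<Delta>. The set \<open>W\<close> collects the cells restored so far.\<close>

definition cells_below :: "'a set set \<Rightarrow> 'c set \<Rightarrow> 'c set" where
  "cells_below \<Delta> W = {x \<in> \<Gamma>. c x \<in> \<Delta> \<or> (\<exists>w\<in>W. le x w)}"

lemma down_closed_cells_below:
  assumes "\<And>A B. A \<in> \<Delta> \<Longrightarrow> B \<subseteq> A \<Longrightarrow> B \<in> \<Delta>" "W \<subseteq> \<Gamma>"
  shows "down_closed (cells_below \<Delta> W)"
  unfolding down_closed_def
proof (intro conjI ballI impI)
  show "cells_below \<Delta> W \<subseteq> \<Gamma>" unfolding cells_below_def by blast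
  fix x y assume *: "x \<in> cells_below \<Delta> W" "y \<in> \<Gamma>" "le y x"
  have x: "x \<in> \<Gamma>" using * unfolding cells_below_def by blast
  consider "c x \<in> \<Delta>" | w where "w \<in> W" "le x w" using * unfolding cells_below_def by blast
  then show "y \<in> cells_below \<Delta> W"
  proof cases
    case 1
    then show ?thesis using assms(1) content_mono[of y x] * x unfolding cells_below_def by blast
  next
    case 2
    then show ?thesis using le_trans[of y x w] * x assms(2) unfolding cells_below_def by blast
  qed
qed

text \<open>The complex \<open>\<Delta>\<close> stands for what remains of a shellable complex after the faces in the
  interval \<open>[\<sigma>, \<tau>]\<close> have been deleted; \<open>\<Delta> = {}\<close>, \<open>\<sigma> = {}\<close> is the case of the full simplex \<open>\<tau>\<close>.\<close>

lemma shellable_insert: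
  assumes closed: "\<And>A B. A \<in> \<Delta> \<Longrightarrow> B \<subseteq> A \<Longrightarrow> B \<in> \<Delta>"
    and \<Delta>S: "\<Delta> \<subseteq> Pow S"
    and new: "\<And>A. A \<subseteq> \<tau> \<Longrightarrow> A \<notin> \<Delta> \<Longrightarrow> \<sigma> \<subseteq> A"
    and old: "\<And>A. A \<in> \<Delta> \<Longrightarrow> \<not> \<sigma> \<subseteq> A" and \<sigma>\<tau>: "\<sigma> \<subseteq> \<tau>"
    and dim: "\<And>A. A \<in> \<Delta> \<Longrightarrow> \<exists>B\<in>\<Delta>. A \<subseteq> B \<and> card B = card \<tau>"
    and W: "W \<subseteq> \<Gamma>" "\<And>x. x \<in> W \<Longrightarrow> c x = \<tau>"
    and w: "w \<in> \<Gamma>" "c w = \<tau>"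
    and exch: "\<And>w' v. w' \<in> W \<Longrightarrow> v \<in> \<Gamma> \<Longrightarrow> le v w \<Longrightarrow> le v w' \<Longrightarrow>
      \<exists>x \<in> \<tau> - c v. \<exists>w''\<in>W. \<exists>u\<in>\<Gamma>. le u w \<and> le u w'' \<and> c u = \<tau> - {x}"
    and shell: "shellable le (cells_below \<Delta> W)"
  shows "shellable le (cells_below \<Delta> (insert w W))"
proof -
  let ?D = "cells_below \<Delta> (insert w W)"
  \<comment> \<open>This is the analogue of the restriction of a facet in a shelling:
    \<open>x\<close> is in \<open>r\<close> when the face of \<open>w\<close> opposite to
    \<open>x\<close> is already present through \<open>W\<close>.\<close>
  define r where "r = {x \<in> \<tau>. \<exists>w''\<in>W. \<exists>u\<in>\<Gamma>. le u w \<and> le u w'' \<and> c u = \<tau> - {x}}"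
  have "\<sigma> \<union> r \<subseteq> c w" using \<sigma>\<tau> w unfolding r_def by auto
  then obtain s where s: "s \<in> \<Gamma>" "le s w" "c s = \<sigma> \<union> r" using face_exists[OF w(1)] by blast
  have dc: "down_closed ?D" using closed W w by (intro down_closed_cells_below) auto
  have wD: "w \<in> ?D" using w le_refl unfolding cells_below_def by auto
  have sD: "s \<in> ?D" using s unfolding cells_below_def by auto
  \<comment> \<open>A cell above \<open>s\<close> contains \<sigma>, so it can only be old by lying
    below some \<open>w'\<close> in \<open>W\<close>. Then \<open>s\<close> is below both
    \<open>w\<close> and \<open>w'\<close>, and \<open>exch\<close> yields an element of
    \<open>r\<close> outside \<open>c s\<close>, although \<open>c s\<close> contains
    \<open>r\<close>.\<close>
  have above: "x \<notin> cells_below \<Delta> W" if x: "x \<in> \<Gamma>" "le s x" for x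
  proof
    assume "x \<in> cells_below \<Delta> W"
    moreover have "\<sigma> \<subseteq> c x" using content_mono[of s x] x s by blast
    ultimately obtain w' where "w' \<in> W" "le x w'" using old unfolding cells_below_def by blast
    moreover from this have "le s w'" using x s W le_trans[of s x w'] by blast
    ultimately show False using exch[of w' s] s unfolding r_def by blast
  qed
  \<comment> \<open>Conversely, the content of a new cell contains \<sigma> by \<open>new\<close>.
    If it missed some \<open>y\<close> in \<open>r\<close>, the cell would lie in the face of
    \<open>w\<close> with content \<open>\<tau> - {y}\<close>, hence below a member of
    \<open>W\<close>.\<close>
  have new_above: "le s x" if x: "x \<in> ?D" "x \<notin> cells_below \<Delta> W" for x
  proof -
    have xw: "x \<in> \<Gamma>" "le x w" "c x \<notin> \<Delta>" using x unfolding cells_below_def by auto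
    have cx: "c x \<subseteq> \<tau>" using content_mono[of x w] xw w by simp
    have "y \<in> c x" if "y \<in> r" for y
    proof (rule ccontr)
      assume "y \<notin> c x"
      obtain w'' u where u: "w'' \<in> W" "u \<in> \<Gamma>" "le u w" "le u w''" "c u = \<tau> - {y}"
        using \<open>y \<in> r\<close> unfolding r_def by blast
      then have "le x u" using le_of_content[of x u w] xw w cx \<open>y \<notin> c x\<close> by blast
      then have "le x w''" using le_trans[of x u w''] u W xw by blast
      then show False using x(2) xw(1) u(1) unfolding cells_below_def by blast
    qed
    then have "c s \<subseteq> c x" using s(3) new[OF cx xw(3)] by blast
    then show ?thesis using le_of_content[of s x w] s xw w by blast
  qed
  have fdel: "fdel le ?D s = cells_below \<Delta> W"
  proof
    show "fdel le ?D s \<subseteq> cells_below \<Delta> W" using new_above unfolding fdel_def by blast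
    show "cells_below \<Delta> W \<subseteq> fdel le ?D s"
      using above unfolding fdel_def cells_below_def by blast
  qed
  \<comment> \<open>The content of a cell above \<open>x\<close> contains \<tau>, hence \<sigma>,
    and so is not in \<Delta>. The cell therefore lies below a member of \<open>insert w W\<close>,
    and its content is exactly \<tau>.\<close>
  have top: "x \<in> maximal_cells le ?D" if x: "x \<in> insert w W" for x
    unfolding maximal_cells_def
  proof (intro CollectI conjI ballI impI)
    have xx: "x \<in> \<Gamma>" "c x = \<tau>" using x W w by auto
    show "x \<in> ?D" using xx(1) x le_refl unfolding cells_below_def by blast
    fix y assume y: "y \<in> ?D" "le x y"
    have yG: "y \<in> \<Gamma>" using y unfolding cells_below_def by simp
    have "\<tau> \<subseteq> c y" using content_mono[of x y] xx y yG by simp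
    then have "\<exists>w'\<in>insert w W. le y w'" using y(1) old \<sigma>\<tau> unfolding cells_below_def by blast
    then have "c y \<subseteq> \<tau>" using content_mono yG w W by blast
    then have "le y x" using le_of_content[of y x y] yG xx y(2) le_refl by blast
    then show "y = x" using le_antisym xx yG y by blast
  qed
  \<comment> \<open>This gives purity: a cell with content in \<Delta> extends within the complex to
    a content of full size, and every other cell lies below one with content \<tau>.\<close>
  have card_top: "card (c x) = card \<tau>" if x: "x \<in> maximal_cells le ?D" for x
  proof -
    have xG: "x \<in> ?D" "x \<in> \<Gamma>" and mx: "\<And>y. y \<in> ?D \<Longrightarrow> le x y \<Longrightarrow> y = x"
      using x unfolding maximal_cells_def cells_below_def by auto
    show ?thesis
    proof (cases "c x \<in> \<Delta>")
      case True
      then obtain B where B: "B \<in> \<Delta>" "c x \<subseteq> B" "card B = card \<tau>" using dim by blast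
      then obtain y where y: "y \<in> \<Gamma>" "le x y" "c y = B" using extension[OF xG(2)] \<Delta>S by blast
      then have "y = x" using mx[of y] B unfolding cells_below_def by simp
      then show ?thesis using y B by simp
    next
      case False
      then obtain w' where w': "w' \<in> insert w W" "le x w'" using xG unfolding cells_below_def by blast
      then have "w' = x" using mx[of w'] top[of w'] unfolding maximal_cells_def by blast
      then show ?thesis using w' W w by auto
    qed
  qed
  show ?thesis
  proof (rule shellable.delete[where \<sigma> = s])
    show "boolean_complex le ?D" using boolean_complex_down_closed[OF dc] wD by blast
    show "pure le ?D"
      unfolding pure_def using card_top cell_dim_content[OF dc]
      by (simp add: maximal_cells_def)
    show "s \<in> ?D" by (fact sD)
    show "shellable le (fdel le ?D s)" using fdel shell by simp
    show "\<exists>!\<tau>. \<tau> \<in> maximal_cells le ?D \<and> le s \<tau>"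
    proof (intro ex1I[of _ w] conjI)
      show "w \<in> maximal_cells le ?D" using top by blast
      show "le s w" by (fact s)
      fix t assume t: "t \<in> maximal_cells le ?D \<and> le s t"
      then have tD: "t \<in> ?D" "t \<in> \<Gamma>" unfolding maximal_cells_def cells_below_def by auto
      then have "t \<notin> cells_below \<Delta> W" using above t by blast
      then have "le t w" using tD unfolding cells_below_def by blast
      then show "t = w" using t wD unfolding maximal_cells_def by blast
    qed
  qed
qed

end

text \<open>The cells with a given content are shelled in the order of increasing \<open>\<kappa>\<close>.\<close>

locale ranked_complex = labelled_complex le \<Gamma> c S
  for le :: "'c \<Rightarrow> 'c \<Rightarrow> bool" and \<Gamma> and c :: "'c \<Rightarrow> 'a set" and S +
  fixes \<kappa> :: "'c \<Rightarrow> 'o :: linorder"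
  assumes rank_inj: "x \<in> \<Gamma> \<Longrightarrow> y \<in> \<Gamma> \<Longrightarrow> c x = c y \<Longrightarrow> \<kappa> x = \<kappa> y \<Longrightarrow> x = y"
    and exchange: "w \<in> \<Gamma> \<Longrightarrow> w' \<in> \<Gamma> \<Longrightarrow> c w' = c w \<Longrightarrow> \<kappa> w' < \<kappa> w \<Longrightarrow>
      v \<in> \<Gamma> \<Longrightarrow> le v w \<Longrightarrow> le v w' \<Longrightarrow>
      \<exists>x \<in> c w - c v. \<exists>w''\<in>\<Gamma>. c w'' = c w \<and> \<kappa> w'' < \<kappa> w \<and>
        (\<exists>u\<in>\<Gamma>. le u w \<and> le u w'' \<and> c u = c w - {x})"
begin

text \<open>\<open>W\<close> runs through the initial segments, in the order of \<kappa>, of the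
  cells with content \<tau>. Each further cell is added by \<open>shellable_insert\<close>, whose
  exchange hypothesis comes from \<open>exchange\<close>. The last assumption excludes the empty
  complex, which is not shellable.\<close>

lemma shellable_segments:
  assumes closed: "\<And>A B. A \<in> \<Delta> \<Longrightarrow> B \<subseteq> A \<Longrightarrow> B \<in> \<Delta>"
    and \<Delta>S: "\<Delta> \<subseteq> Pow S"
    and new: "\<And>A. A \<subseteq> \<tau> \<Longrightarrow> A \<notin> \<Delta> \<Longrightarrow> \<sigma> \<subseteq> A"
    and old: "\<And>A. A \<in> \<Delta> \<Longrightarrow> \<not> \<sigma> \<subseteq> A" and \<sigma>\<tau>: "\<sigma> \<subseteq> \<tau>"
    and dim: "\<And>A. A \<in> \<Delta> \<Longrightarrow> \<exists>B\<in>\<Delta>. A \<subseteq> B \<and> card B = card \<tau>"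
    and start: "\<Delta> = {} \<or> shellable le (cells_below \<Delta> {})"
    and "finite W" "W \<subseteq> {x \<in> \<Gamma>. c x = \<tau>}"
    and "\<forall>x\<in>W. \<forall>y\<in>\<Gamma>. c y = \<tau> \<and> \<kappa> y < \<kappa> x \<longrightarrow> y \<in> W"
    and "\<Delta> \<noteq> {} \<or> W \<noteq> {}"
  shows "shellable le (cells_below \<Delta> W)"
  using assms(8-)
proof (induction W rule: finite_ranking_induct[where f = \<kappa>])
  case empty
  then show ?case using start by blast
next
  case (insert w W)
  show ?case
  \<comment> \<open>The induction rule allows \<open>w\<close> to lie in \<open>W\<close> already.
    The other special case is the first cell over \<open>\<Delta> = {}\<close>, where the complex is
    a single simplex.\<close>
  proof (cases "w \<in> W \<or> (\<Delta> = {} \<and> W = {})")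
    case True
    then show ?thesis
    proof
      assume "w \<in> W"
      then show ?thesis using insert by (simp add: insert_absorb)
    next
      assume *: "\<Delta> = {} \<and> W = {}"
      have "cells_below \<Delta> (insert w W) = faces le \<Gamma> w"
        using * unfolding cells_below_def faces_def by auto
      moreover have "down_closed \<Gamma>" "w \<in> \<Gamma>" using insert.prems unfolding down_closed_def by auto
      ultimately show ?thesis using faces_iso_Pow[of \<Gamma> w] shellable.simplex by metis
    qed
  next
    case False
    have lt: "\<kappa> y < \<kappa> w" if "y \<in> W" for y
    proof -
      have "y \<noteq> w" using that False by blast
      then have "\<kappa> y \<noteq> \<kappa> w" using rank_inj[of y w] insert.prems(1) that by auto
      then show ?thesis using insert.hyps(2)[OF that] by order
    qed
    have init: "\<forall>x\<in>W. \<forall>y\<in>\<Gamma>. c y = \<tau> \<and> \<kappa> y < \<kappa> x \<longrightarrow> y \<in> W"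
      using insert.prems(2) lt by (metis insertE insertI2 order_less_asym)
    have IH: "shellable le (cells_below \<Delta> W)"
      using insert.IH insert.prems(1) init False by blast
    show ?thesis
    proof (rule shellable_insert[where \<sigma> = \<sigma> and \<tau> = \<tau>])
      show "\<exists>x\<in>\<tau> - c v. \<exists>w''\<in>W. \<exists>u\<in>\<Gamma>. le u w \<and> le u w'' \<and> c u = \<tau> - {x}"
        if v: "w' \<in> W" "v \<in> \<Gamma>" "le v w" "le v w'" for w' v
      proof -
        have c: "w \<in> \<Gamma>" "w' \<in> \<Gamma>" "c w' = \<tau>" "c w = \<tau>" using insert.prems(1) v by auto
        obtain x w'' u where "x \<in> \<tau> - c v" and w'': "w'' \<in> \<Gamma>" "c w'' = \<tau>" "\<kappa> w'' < \<kappa> w"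
          and "u \<in> \<Gamma>" "le u w" "le u w''" "c u = \<tau> - {x}"
          using exchange[of w w' v] lt[OF v(1)] v c unfolding c by blast
        moreover have "w'' \<in> W" using insert.prems(2) w'' by (metis insertE insertI1 order_less_irrefl)
        ultimately show ?thesis by blast
      qed
      show "W \<subseteq> \<Gamma>" "\<And>x. x \<in> W \<Longrightarrow> c x = \<tau>" "w \<in> \<Gamma>" "c w = \<tau>"
        using insert.prems(1) by blast+
    qed (fact assms(1-6) IH)+
  qed
qed

text \<open>With \<open>\<Delta> = {}\<close> and \<open>\<sigma> = {}\<close> the cells with
  content \<open>F\<close> are shelled from nothing. By \<open>extension\<close>, their faces are
  all the cells with content inside \<open>F\<close>.\<close>

lemma shellable_simplex:
  assumes "F \<subseteq> S"
  shows "shellable le (cells_below (Pow F) {})"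
proof -
  let ?W = "{x \<in> \<Gamma>. c x = F}"
  obtain x where "x \<in> \<Gamma>" using nonempty by blast
  then obtain e where "e \<in> \<Gamma>" "c e = {}" using face_exists by blast
  then have "?W \<noteq> {}" using extension[of e F] assms by blast
  have "shellable le (cells_below {} ?W)"
    by (rule shellable_segments[where \<sigma> = "{}" and \<tau> = F]) (use finite_cells \<open>?W \<noteq> {}\<close> in simp_all)
  moreover have "cells_below {} ?W = cells_below (Pow F) {}"
  proof (rule set_eqI)
    fix x
    have "(\<exists>w\<in>\<Gamma>. c w = F \<and> le x w) \<longleftrightarrow> c x \<subseteq> F" if "x \<in> \<Gamma>"
      using extension[OF that _ assms] content_mono[OF that] by metis
    then show "x \<in> cells_below {} ?W \<longleftrightarrow> x \<in> cells_below (Pow F) {}"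
      unfolding cells_below_def by auto
  qed
  ultimately show ?thesis by simp
qed

end

text \<open>Simplicial faces serve as their own contents, so \<open>cell_dim_content\<close> yields
  the dimension of a face of \<Delta> from its cardinality.\<close>

lemma labelled_complex_Pow: "finite S \<Longrightarrow> labelled_complex (\<subseteq>) (Pow S) (\<lambda>A. A) S"
  by unfold_locales auto

section \<open>Induction along a shelling of the base complex\<close>

context ranked_complex
begin

theorem shellable_over:
  assumes "shellable (\<subseteq>) \<Delta>" "simplicial_complex S \<Delta>"
  shows "shellable le (cells_below \<Delta> {})"
  using assms
proof (induction rule: shellable.induct)
  case (simplex \<Omega> \<Delta>)
  obtain F where "F \<in> \<Delta>" "\<And>A. A \<in> \<Delta> \<Longrightarrow> A \<subseteq> F"
    using iso_Pow_greatest[OF simplex(2)] by metis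
  then have "\<Delta> = Pow F" "F \<subseteq> S" using simplex(3) unfolding simplicial_complex_def by auto
  then show ?case using shellable_simplex by simp
next
  case (delete \<Delta> \<sigma>)
  let ?D = "fdel (\<subseteq>) \<Delta> \<sigma>"
  interpret P: labelled_complex "(\<subseteq>)" "Pow S" "\<lambda>A. A" S
    using labelled_complex_Pow finite_labels .
  have \<Delta>: "\<Delta> \<subseteq> Pow S" "\<And>A B. A \<in> \<Delta> \<Longrightarrow> B \<subseteq> A \<Longrightarrow> B \<in> \<Delta>"
    using delete.prems unfolding simplicial_complex_def by blast+
  have fin: "finite \<Delta>" using \<Delta>(1) finite_labels finite_subset by blast
  have D: "?D \<subseteq> \<Delta>" "\<And>A B. A \<in> ?D \<Longrightarrow> B \<subseteq> A \<Longrightarrow> B \<in> ?D"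
    using \<Delta>(2) unfolding fdel_def by blast+
  obtain A where "A \<in> ?D" using shellable_nonempty[OF delete.hyps(5)] by blast
  then have "{} \<in> ?D" using D(2) by blast
  have sD: "simplicial_complex S ?D"
    unfolding simplicial_complex_def using D \<open>{} \<in> ?D\<close> \<Delta>(1) by blast
  obtain \<tau> where \<tau>: "\<tau> \<in> maximal_cells (\<subseteq>) \<Delta>" "\<sigma> \<subseteq> \<tau>"
    and uniq: "\<And>\<tau>'. \<tau>' \<in> maximal_cells (\<subseteq>) \<Delta> \<Longrightarrow> \<sigma> \<subseteq> \<tau>' \<Longrightarrow> \<tau>' = \<tau>"
    using delete.hyps(4) by blast
  have \<tau>\<Delta>: "\<tau> \<in> \<Delta>" "\<tau> \<subseteq> S" using \<tau> \<Delta>(1) unfolding maximal_cells_def by auto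
  show ?case
  \<comment> \<open>If \<tau> is the only facet, the deletion may drop in dimension, so this simplex
    is treated directly.\<close>
  proof (cases "maximal_cells (\<subseteq>) \<Delta> = {\<tau>}")
    case True
    then have "\<Delta> = Pow \<tau>"
      using subset_maximal_cell[OF fin] \<tau>\<Delta>(1) \<Delta>(2) by (metis Pow_iff antisym singletonD subsetI)
    then show ?thesis using shellable_simplex \<tau>\<Delta> by simp
  next
    case False
    then obtain \<rho> where \<rho>: "\<rho> \<in> maximal_cells (\<subseteq>) \<Delta>" "\<rho> \<noteq> \<tau>" using \<tau>(1) by blast
    have dcl: "P.down_closed \<Delta>" "P.down_closed ?D"
      unfolding P.down_closed_def
      by (intro conjI ballI impI, use \<Delta>(1) D(1) in blast, erule (1) \<Delta>(2) D(2))+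
    have "cell_dim (\<subseteq>) \<Delta> \<rho> = cell_dim (\<subseteq>) \<Delta> \<tau>"
      using delete.hyps(2) \<rho>(1) \<tau>(1) unfolding pure_def by blast
    then have "card \<rho> = card \<tau>"
      using P.cell_dim_content[OF dcl(1)] \<rho>(1) \<tau>\<Delta>(1) by (simp add: maximal_cells_def)
    \<comment> \<open>A facet other than \<tau> does not contain \<sigma> and survives as a facet of
      the deletion. By purity of the deletion its size carries over to all facets there.\<close>
    moreover have \<rho>D: "\<rho> \<in> maximal_cells (\<subseteq>) ?D"
      using \<rho> uniq[of \<rho>] D(1) unfolding maximal_cells_def fdel_def by blast
    moreover have "card B = card \<rho>" if "B \<in> maximal_cells (\<subseteq>) ?D" for B
    proof -
      have "cell_dim (\<subseteq>) ?D B = cell_dim (\<subseteq>) ?D \<rho>"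
        using shellable_pure[OF delete.hyps(5)] that \<rho>D unfolding pure_def by blast
      then show ?thesis
        using P.cell_dim_content[OF dcl(2)] that \<rho>D by (simp add: maximal_cells_def)
    qed
    ultimately have card_max: "card B = card \<tau>" if "B \<in> maximal_cells (\<subseteq>) ?D" for B
      using that by metis
    let ?W = "{x \<in> \<Gamma>. c x = \<tau>}"
    have "shellable le (cells_below ?D ?W)"
    proof (rule shellable_segments[where \<sigma> = \<sigma> and \<tau> = \<tau>])
      show "\<exists>B\<in>?D. A \<subseteq> B \<and> card B = card \<tau>" if "A \<in> ?D" for A
      proof -
        have "finite ?D" using D(1) fin finite_subset by blast
        from subset_maximal_cell[OF this that]
        obtain B where B: "B \<in> maximal_cells (\<subseteq>) ?D" "A \<subseteq> B" .
        then have "B \<in> ?D" unfolding maximal_cells_def by blast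
        then show ?thesis using B card_max[of B] by blast
      qed
      show "?D = {} \<or> shellable le (cells_below ?D {})" using delete.IH sD by blast
      show "A \<in> ?D \<Longrightarrow> B \<subseteq> A \<Longrightarrow> B \<in> ?D" for A B by (fact D(2))
      show "A \<subseteq> \<tau> \<Longrightarrow> A \<notin> ?D \<Longrightarrow> \<sigma> \<subseteq> A" for A
        using \<tau>\<Delta> \<Delta>(2) unfolding fdel_def by blast
      show "A \<in> ?D \<Longrightarrow> \<not> \<sigma> \<subseteq> A" for A unfolding fdel_def by blast
      show "?D \<subseteq> Pow S" using D \<Delta> by blast
    qed (use \<tau> finite_cells \<open>{} \<in> ?D\<close> in \<open>simp_all, blast?\<close>)
    moreover have "cells_below ?D ?W = cells_below \<Delta> {}"
    proof
      show "cells_below ?D ?W \<subseteq> cells_below \<Delta> {}"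
        using D(1) \<tau>\<Delta> \<Delta>(2) content_mono unfolding cells_below_def by blast
      show "cells_below \<Delta> {} \<subseteq> cells_below ?D ?W"
      proof
        fix x assume "x \<in> cells_below \<Delta> {}"
        then have x: "x \<in> \<Gamma>" "c x \<in> \<Delta>" unfolding cells_below_def by auto
        show "x \<in> cells_below ?D ?W"
        \<comment> \<open>A content containing \<sigma> lies in no facet except \<tau>, so the cell
          extends to one with content \<tau>.\<close>
        proof (cases "\<sigma> \<subseteq> c x")
          case True
          obtain B where "B \<in> maximal_cells (\<subseteq>) \<Delta>" "c x \<subseteq> B"
            using subset_maximal_cell[OF fin x(2)] .
          then have "c x \<subseteq> \<tau>" using uniq[of B] True by blast
          then show ?thesis using extension[OF x(1)] \<tau>\<Delta> x unfolding cells_below_def by blast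
        next
          case False
          then show ?thesis using x unfolding cells_below_def fdel_def by blast
        qed
      qed
    qed
    ultimately show ?thesis by simp
  qed
qed

end

section \<open>Words\<close>

lemma subseq_set_subset: "subseq v w \<Longrightarrow> set v \<subseteq> set w"
  by (auto elim: list_emb_set)

text \<open>An injective word has only one subword with a given letter set. This turns the subword
  order into a computation with filters.\<close>

lemma subseq_eq_filter: "subseq v w \<Longrightarrow> distinct w \<Longrightarrow> v = filter (\<lambda>x. x \<in> set v) w"
proof (induction rule: list_emb.induct)
  case (list_emb_Cons xs ys y)
  then show ?case using subseq_set_subset by fastforce
next
  case (list_emb_Cons2 x y xs ys)
  then have "filter (\<lambda>z. z = x \<or> z \<in> set xs) ys = filter (\<lambda>z. z \<in> set xs) ys"
    by (intro filter_cong) auto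
  then show ?case using list_emb_Cons2 by simp
qed simp

lemma filter_filter_subset: "A \<subseteq> B \<Longrightarrow>
    filter (\<lambda>x. x \<in> A) (filter (\<lambda>x. x \<in> B) w) = filter (\<lambda>x. x \<in> A) w"
  unfolding filter_filter by (rule filter_cong) auto

lemma map_less_append:
  fixes f :: "'a \<Rightarrow> nat"
  shows "f b < f a \<Longrightarrow> map f (u @ b # y) < map f (u @ a # z)"
  by (simp add: list_less_def lexord_append_left_rightI)

text \<open>At the first difference \<open>a\<close> stands in \<open>w\<close> and the smaller
  \<open>b\<close> in \<open>w'\<close>. As both words are injective with the same letters and agree
  before that position, \<open>b\<close> occurs in \<open>w\<close> after \<open>a\<close>. Equal
  lengths rule out a proper prefix.\<close>

lemma map_less_decomp:
  fixes f :: "'a \<Rightarrow> nat"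
  assumes "map f w' < map f w" "distinct w" "distinct w'" "set w' = set w" "inj_on f (set w)"
  obtains u a p b q q' where "w = u @ a # p @ b # q" "w' = u @ b # q'" "f b < f a"
proof -
  have len: "length w' = length w" using assms by (metis distinct_card)
  obtain k where k: "k < length w" "f (w' ! k) < f (w ! k)" "\<And>i. i < k \<Longrightarrow> f (w' ! i) = f (w ! i)"
  proof -
    have "(map f w', map f w) \<in> lexord {(u, v). u < v}" using assms(1) by (simp add: list_less_def)
    then obtain k where k: "k < length w" "take k (map f w') = take k (map f w)"
      "map f w' ! k < map f w ! k"
      using len unfolding lexord_take_index_conv by auto
    have "f (w' ! i) = f (w ! i)" if "i < k" for i
      using arg_cong[OF k(2), of "\<lambda>l. l ! i"] that k(1) len by simp
    then show ?thesis using that k len by auto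
  qed
  have same: "w' ! i = w ! i" if "i < k" for i
    using k(3)[OF that] assms(4,5) that k(1) len unfolding inj_on_def
    by (metis nth_mem order.strict_trans)
  have tk: "take k w' = take k w"
    using same k(1) len by (intro nth_equalityI) auto
  have w: "w = take k w @ w ! k # drop (Suc k) w" using k(1) by (rule id_take_nth_drop)
  have w': "w' = take k w @ w' ! k # drop (Suc k) w'"
    using id_take_nth_drop[of k w'] k(1) len tk by simp
  have "w' ! k \<in> set w" using k(1) len assms(4) nth_mem[of k w'] by simp
  moreover have "w' ! k \<notin> set (take k w)"
    using assms(3) arg_cong[OF w', of distinct] unfolding distinct_append by force
  moreover have "w' ! k \<noteq> w ! k" using k(2) by auto
  ultimately have "w' ! k \<in> set (drop (Suc k) w)" using arg_cong[OF w, of set] unfolding set_append list.set by blast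
  then obtain p q where "drop (Suc k) w = p @ w' ! k # q" by (meson split_list)
  then show ?thesis using that[OF _ w' k(2)] w by simp
qed

text \<open>If \<open>a\<close> and \<open>b\<close> are both in a word below two words, then these order \<open>a\<close> and \<open>b\<close> alike.\<close>

lemma filter_pair:
  assumes "distinct (xs @ a # ys @ b # zs)"
  shows "filter (\<lambda>x. x = a \<or> x = b) (xs @ a # ys @ b # zs) = [a, b]"
proof -
  have "filter (\<lambda>x. x = a \<or> x = b) l = []" if "a \<notin> set l" "b \<notin> set l" for l
    using that by (auto simp: filter_empty_conv)
  then show ?thesis using assms by auto
qed

section \<open>Words compatible with a partial order\<close>

definition compatible :: "'a rel \<Rightarrow> 'a list \<Rightarrow> bool" where
  "compatible P w \<longleftrightarrow> distinct w \<and> sorted_wrt (\<lambda>x y. (y, x) \<notin> P) w"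

text \<open>Different positions of an injective word carry different letters, which absorbs the
  strictness in the index condition. The \<open>sorted_wrt\<close> form splits along concatenations
  and passes to filters.\<close>

lemma poset_words_iff: "w \<in> poset_words \<Delta> P \<longleftrightarrow> compatible P w \<and> set w \<in> \<Delta>"
proof (cases "distinct w")
  case True
  have "(\<forall>i<length w. \<forall>j<length w. (w ! i, w ! j) \<in> P \<and> w ! i \<noteq> w ! j \<longrightarrow> i < j) \<longleftrightarrow>
      sorted_wrt (\<lambda>x y. (y, x) \<notin> P) w"
    (is "?L \<longleftrightarrow> ?R")
  proof
    assume L: ?L
    show ?R
      unfolding sorted_wrt_iff_nth_less
    proof (intro allI impI notI)
      fix i j assume "i < j" "j < length w" "(w ! j, w ! i) \<in> P"
      moreover from this have "w ! j \<noteq> w ! i" using True nth_eq_iff_index_eq[of w j i] by simp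
      ultimately have "j < i" using L by simp
      then show False using \<open>i < j\<close> by simp
    qed
  next
    assume R: ?R
    show ?L
    proof (intro allI impI)
      fix i j assume ij: "i < length w" "j < length w" "(w ! i, w ! j) \<in> P \<and> w ! i \<noteq> w ! j"
      then have "\<not> j < i" using R unfolding sorted_wrt_iff_nth_less by blast
      moreover have "i \<noteq> j" using ij by blast
      ultimately show "i < j" by simp
    qed
  qed
  then show ?thesis using True unfolding poset_words_def inj_words_def compatible_def by auto
qed (simp add: poset_words_def inj_words_def compatible_def)

text \<open>The letter \<open>x\<close> goes directly before the first letter above it, or to the
  end if there is none.\<close>

lemma compatible_insert:
  assumes P: "trans P" "antisym P" and w: "compatible P w" and x: "x \<notin> set w"
  obtains w' where "compatible P w'" "subseq w w'" "set w' = insert x (set w)"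
proof -
  define p q where "p = takeWhile (\<lambda>y. (x, y) \<notin> P) w" and "q = dropWhile (\<lambda>y. (x, y) \<notin> P) w"
  have pq: "w = p @ q" unfolding p_def q_def by simp
  have p: "\<forall>y\<in>set p. (x, y) \<notin> P" unfolding p_def by (auto dest: set_takeWhileD)
  \<comment> \<open>A letter \<open>y\<close> of \<open>q\<close> below \<open>x\<close> would by
    transitivity be below the first letter \<open>s\<close> of \<open>q\<close>, against the
    compatibility of \<open>w\<close>; antisymmetry excludes \<open>y = s\<close>.\<close>
  have q: "(y, x) \<notin> P" if y: "y \<in> set q" for y
  proof
    assume yx: "(y, x) \<in> P"
    obtain s t where st: "q = s # t" using y by (cases q) auto
    have "(x, s) \<in> P" using st hd_dropWhile[of "\<lambda>y. (x, y) \<notin> P" w] unfolding q_def by simp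
    moreover from this have "(y, s) \<in> P" using yx P(1) by (meson transD)
    ultimately show False
      using w y x P(2) yx unfolding pq st compatible_def
      by (auto simp: sorted_wrt_append dest: antisymD)
  qed
  show ?thesis
  proof (rule that[of "p @ x # q"])
    show "compatible P (p @ x # q)"
      using w x p q unfolding pq compatible_def by (auto simp: sorted_wrt_append)
    show "subseq w (p @ x # q)" 
      unfolding pq by (intro list_emb_append_mono list_emb_Cons subseq_order.order_refl)
    show "set (p @ x # q) = insert x (set w)" unfolding pq by auto
  qed
qed

lemma compatible_extend:
  assumes P: "trans P" "antisym P" and w: "compatible P w"
    and "finite B" "B \<inter> set w = {}"
  shows "\<exists>w'. compatible P w' \<and> subseq w w' \<and> set w' = set w \<union> B"
  using assms(4-)
proof (induction B rule: finite_induct)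
  case empty
  then show ?case using w by (intro exI[of _ w]) simp
next
  case (insert x B)
  then obtain w' where w': "compatible P w'" "subseq w w'" "set w' = set w \<union> B" by auto
  moreover have "x \<notin> set w'" using insert w' by auto
  ultimately obtain w'' where "compatible P w''" "subseq w' w''" "set w'' = insert x (set w')"
    using compatible_insert[OF P] by metis
  then show ?case using w' subseq_order.order_trans[of w w' w''] by (intro exI[of _ w'']) auto
qed

text \<open>Extending the empty word to a compatible word on all of \<open>S\<close> gives a linear
  extension of \<open>P\<close>; the label of a letter is its position there.\<close>

lemma natural_labelling:
  fixes P :: "'a rel"
  assumes P: "trans P" "antisym P" and "finite S"
  obtains f :: "'a \<Rightarrow> nat" where "inj_on f S"
    "\<And>x y. x \<in> S \<Longrightarrow> y \<in> S \<Longrightarrow> f y < f x \<Longrightarrow> (x, y) \<notin> P"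
proof -
  obtain L where L: "compatible P L" "set L = S"
    using compatible_extend[OF P, of "[]" S] assms(3) unfolding compatible_def by auto
  define f where "f = inv_into {..<length L} ((!) L)"
  have inj: "inj_on ((!) L) {..<length L}"
    using L(1) unfolding compatible_def by (intro inj_on_nth) auto
  have img: "(!) L ` {..<length L} = S" using L(2) by (auto simp: set_conv_nth)
  have f: "f x < length L" "L ! f x = x" if "x \<in> S" for x
    using inv_into_into[of x "(!) L" "{..<length L}"] f_inv_into_f[of x "(!) L" "{..<length L}"]
      that unfolding f_def img by auto
  show ?thesis
  proof
    show "inj_on f S" using f(2) by (metis inj_onI)
    show "(x, y) \<notin> P" if "x \<in> S" "y \<in> S" "f y < f x" for x y
      using L(1) that f[of x] f[of y] unfolding compatible_def sorted_wrt_iff_nth_less by metis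
  qed
qed

text \<open>Let \<open>b\<close> replace \<open>a\<close> at the first difference. If
  \<open>b\<close> is not in \<open>v\<close>, it can be pulled forward in \<open>w\<close> to the
  place before \<open>a\<close>. Otherwise \<open>w\<close> has a descent at adjacent letters
  \<open>x\<close>, \<open>z\<close> with \<open>x\<close> not in \<open>v\<close>, and swapping
  them keeps compatibility because the labelling is natural.\<close>

lemma compatible_exchange:
  fixes f :: "'a \<Rightarrow> nat"
  assumes w: "compatible P w" and w': "compatible P w'" and sets: "set w' = set w"
    and inj: "inj_on f (set w)"
    and nat: "\<And>x y. x \<in> set w \<Longrightarrow> y \<in> set w \<Longrightarrow> f y < f x \<Longrightarrow> (x, y) \<notin> P"
    and less: "map f w' < map f w" and v: "subseq v w" "subseq v w'"
  obtains x w'' where "x \<in> set w - set v" "compatible P w''" "set w'' = set w"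
    "map f w'' < map f w" "filter (\<lambda>y. y \<noteq> x) w'' = filter (\<lambda>y. y \<noteq> x) w"
proof -
  have d: "distinct w" "distinct w'" using w w' unfolding compatible_def by auto
  obtain u a p b q q' where dec: "w = u @ a # p @ b # q" "w' = u @ b # q'" "f b < f a"
    using map_less_decomp[OF less d sets inj] .
  show ?thesis
  proof (cases "b \<in> set v")
    case False
    have "set (a # p) \<subseteq> set q'" using sets d unfolding dec by auto
    \<comment> \<open>In \<open>w'\<close> the letter \<open>b\<close> precedes all of
      \<open>a # p\<close>, so none of these letters is forced to come before
      \<open>b\<close>.\<close>
    then have before: "\<forall>t\<in>set (a # p). (t, b) \<notin> P"
      using w' unfolding dec compatible_def by (auto simp: sorted_wrt_append)
    let ?w = "u @ b # a # p @ q"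
    show ?thesis
    proof (rule that[of b ?w])
      show "b \<in> set w - set v" using False dec by simp
      show "compatible P ?w"
        using w before unfolding dec compatible_def by (auto simp: sorted_wrt_append)
      show "set ?w = set w" unfolding dec by auto
      show "map f ?w < map f w" unfolding dec using dec(3) by (rule map_less_append)
      show "filter (\<lambda>y. y \<noteq> b) ?w = filter (\<lambda>y. y \<noteq> b) w" unfolding dec by simp
    qed
  next
    case True
    \<comment> \<open>\<open>w\<close> and \<open>w'\<close> order \<open>t\<close> and
      \<open>b\<close> oppositely, so their common subword \<open>v\<close>, which contains
      \<open>b\<close>, cannot contain \<open>t\<close>.\<close>
    have free: "t \<notin> set v" if t: "t \<in> set (a # p)" for t
    proof
      assume "t \<in> set v"
      define R where "R = (\<lambda>x. x = t \<or> x = b)"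
      obtain p1 p2 where "a # p = p1 @ t # p2" using split_list[OF t] by blast
      then have "w = (u @ p1) @ t # p2 @ b # q" unfolding dec by simp
      then have "filter R w = [t, b]" using filter_pair d(1) unfolding R_def by metis
      moreover have "t \<in> set q'" using t sets d unfolding dec by auto
      then obtain r1 r2 where "q' = r1 @ t # r2" using split_list by metis
      then have "filter R w' = [b, t]"
        using filter_pair[of u b r1 t r2] d(2) unfolding R_def dec by (simp add: disj_commute)
      moreover have "filter R w = filter R v" "filter R w' = filter R v"
      proof -
        have "filter R (filter (\<lambda>x. x \<in> set v) l) = filter R l" for l
          using True \<open>t \<in> set v\<close> unfolding R_def filter_filter by (intro filter_cong) auto
        then show "filter R w = filter R v" "filter R w' = filter R v"
          using subseq_eq_filter v d by metis+
      qed
      moreover have "t \<noteq> b" using t d unfolding dec by auto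
      ultimately show False by simp
    qed
    \<comment> \<open>Here \<open>z\<close> is the first letter after \<open>a\<close> with a label
      below \<open>f a\<close>, and \<open>x\<close> is its predecessor. The letters from
      \<open>a\<close> to \<open>x\<close> have labels at least \<open>f a\<close>, so
      \<open>x\<close>, \<open>z\<close> form a descent.\<close>
    have "\<exists>z\<in>set (p @ [b]). f z < f a" using dec(3) by simp
    then obtain p1 z p2 where p1: "p @ [b] = p1 @ z # p2" "f z < f a" "\<forall>y\<in>set p1. \<not> f y < f a"
      using split_list_first_prop[of "p @ [b]" "\<lambda>z. f z < f a"] by blast
    obtain r x where r: "a # p1 = r @ [x]" by (metis rev_exhaust list.discI)
    have wr: "w = (u @ r) @ x # z # p2 @ q"
      using p1(1) r unfolding dec by (metis append.assoc append_Cons append_Nil)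
    have "x \<in> set (a # p1)" using r by simp
    then have zx: "f z < f x" using p1 by auto
    have "set p1 \<subseteq> set p"
      using p1(1) by (cases p2 rule: rev_cases) auto
    then have "x \<in> set (a # p)" using \<open>x \<in> set (a # p1)\<close> by auto
    then have "x \<notin> set v" using free by blast
    let ?w = "(u @ r) @ z # x # p2 @ q"
    have "(x, z) \<notin> P" using nat zx unfolding wr by simp
    show ?thesis
    proof (rule that[of x ?w])
      show "x \<in> set w - set v" using \<open>x \<notin> set v\<close> unfolding wr by simp
      show "compatible P ?w"
        using w \<open>(x, z) \<notin> P\<close> unfolding wr compatible_def by (auto simp: sorted_wrt_append)
      show "set ?w = set w" unfolding wr by auto
      show "map f ?w < map f w" unfolding wr using zx by (rule map_less_append)
      show "filter (\<lambda>y. y \<noteq> x) ?w = filter (\<lambda>y. y \<noteq> x) w" unfolding wr by simp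
    qed
  qed
qed

lemma compatible_filter: "compatible P w \<Longrightarrow> compatible P (filter Q w)"
  unfolding compatible_def by (simp add: sorted_wrt_filter)

text \<open>The compatible words over the full simplex, ranked lexicographically by a natural
  labelling, form a \<open>ranked_complex\<close>; those with content in \<Delta> are then covered
  by \<open>shellable_over\<close>.\<close>

lemma shellable_poset_words:
  fixes S :: "'a set"
  assumes S: "finite S" and \<Delta>: "simplicial_complex S \<Delta>" "shellable (\<subseteq>) \<Delta>"
    and P: "trans P" "antisym P"
  shows "shellable subseq (poset_words \<Delta> P)"
proof -
  obtain f :: "'a \<Rightarrow> nat" where f: "inj_on f S"
    "\<And>x y. x \<in> S \<Longrightarrow> y \<in> S \<Longrightarrow> f y < f x \<Longrightarrow> (x, y) \<notin> P"
    using natural_labelling[OF P S] by metis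
  let ?G = "poset_words (Pow S) P"
  have G: "w \<in> ?G \<longleftrightarrow> compatible P w \<and> set w \<subseteq> S" for w by (simp add: poset_words_iff)
  have d: "distinct w" if "w \<in> ?G" for w using that unfolding G compatible_def by blast
  interpret ranked_complex subseq ?G set S "map f"
  proof
    have "?G \<subseteq> {w. set w \<subseteq> S \<and> distinct w}" using G d by blast
    then show "finite ?G" using finite_subset_distinct[OF S] finite_subset by blast
    show "finite S" by (fact S)
    show "set x \<subseteq> S" if "x \<in> ?G" for x using that G by blast
    show "set x \<subseteq> set y" if "subseq x y" for x y :: "'a list" using that by (rule subseq_set_subset)
    show "subseq x y" if "x \<in> ?G" "y \<in> ?G" "z \<in> ?G" "subseq x z" "subseq y z" "set x \<subseteq> set y" for x y z
    proof -
      have "y = filter (\<lambda>a. a \<in> set y) z" "x = filter (\<lambda>a. a \<in> set x) z"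
        using that d subseq_eq_filter by blast+
      then have "x = filter (\<lambda>a. a \<in> set x) y" using filter_filter_subset[OF that(6)] by metis
      then show ?thesis by (metis subseq_filter_left)
    qed
    show "\<exists>y\<in>?G. subseq y x \<and> set y = A" if "x \<in> ?G" "A \<subseteq> set x" for x A
      using that G compatible_filter by (intro bexI[of _ "filter (\<lambda>a. a \<in> A) x"]) auto
    show "\<exists>y\<in>?G. subseq x y \<and> set y = F" if x: "x \<in> ?G" "set x \<subseteq> F" "F \<subseteq> S" for x F
    proof -
      have fin: "finite (F - set x)" using x S finite_subset by blast
      have disj: "(F - set x) \<inter> set x = {}" by blast
      obtain y where "compatible P y" "subseq x y" "set y = set x \<union> (F - set x)"
        using compatible_extend[OF P _ fin disj] x(1)[unfolded G] by blast
      then show ?thesis using x(2,3) by (intro bexI[of _ y]) (auto simp: G)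
    qed
    have "[] \<in> ?G" unfolding G compatible_def by simp
    then show "?G \<noteq> {}" by blast
    show "subseq x y" if "set x = {}" for x y :: "'a list" using that by simp
    show "x = y" if "x \<in> ?G" "y \<in> ?G" "set x = set y" "map f x = map f y" for x y
      using that f(1) G by (metis inj_on_subset map_inj_on Un_absorb)
    fix w w' v
    assume w: "w \<in> ?G" "w' \<in> ?G" "set w' = set w" "map f w' < map f w" "v \<in> ?G"
      "subseq v w" "subseq v w'"
    have wc: "compatible P w" "compatible P w'" and wS: "set w \<subseteq> S"
      using w(1,2) unfolding G by simp_all
    have nat: "(x, y) \<notin> P" if "x \<in> set w" "y \<in> set w" "f y < f x" for x y
      using f(2) that wS by blast
    from compatible_exchange[OF wc w(3) inj_on_subset[OF f(1) wS] nat w(4,6,7)]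
    obtain x w'' where x: "x \<in> set w - set v" and w'': "compatible P w''" "set w'' = set w"
      "map f w'' < map f w" and fil: "filter (\<lambda>y. y \<noteq> x) w'' = filter (\<lambda>y. y \<noteq> x) w"
      by blast
    let ?u = "filter (\<lambda>y. y \<noteq> x) w"
    have "?u \<in> ?G" "set ?u = set w - {x}"
      using wc(1) wS compatible_filter unfolding G by auto
    moreover have "subseq ?u w" "subseq ?u w''" using fil by (metis subseq_filter_left)+
    moreover have "w'' \<in> ?G" using w''(1,2) wS unfolding G by simp
    ultimately show "\<exists>x\<in>set w - set v. \<exists>w''\<in>?G. set w'' = set w \<and> map f w'' < map f w \<and>
        (\<exists>u\<in>?G. subseq u w \<and> subseq u w'' \<and> set u = set w - {x})"
      using x w'' by blast
  qed auto
  have "cells_below \<Delta> {} = poset_words \<Delta> P"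
    using \<Delta>(1) by (auto simp: cells_below_def poset_words_iff simplicial_complex_def)
  then show ?thesis using shellable_over[OF \<Delta>(2,1)] by simp
qed

section \<open>Commutation classes\<close>

abbreviation comm_eq :: "'a set set \<Rightarrow> 'a list \<Rightarrow> 'a list \<Rightarrow> bool" where
  "comm_eq E v w \<equiv> (v, w) \<in> (commutations E)\<^sup>*"

lemma comm_eq_sym: "comm_eq E v w \<Longrightarrow> comm_eq E w v"
proof -
  have "sym (commutations E)"
  proof (rule symI)
    fix v w assume "(v, w) \<in> commutations E"
    then obtain p s s' q where "v = p @ [s, s'] @ q" "w = p @ [s', s] @ q" "{s', s} \<notin> E"
      unfolding commutations_def by (auto simp: insert_commute)
    then show "(w, v) \<in> commutations E" unfolding commutations_def by blast
  qed
  then show "comm_eq E v w \<Longrightarrow> comm_eq E w v" by (meson sym_rtrancl symD)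
qed

lemma comm_eq_trans: "comm_eq E u v \<Longrightarrow> comm_eq E v w \<Longrightarrow> comm_eq E u w"
  by (rule rtrancl_trans)

lemma comm_class_eq_iff: "comm_class E v = comm_class E w \<longleftrightarrow> comm_eq E v w"
  unfolding comm_class_def using comm_eq_sym comm_eq_trans by blast

lemma in_comm_class_iff: "v \<in> comm_class E w \<longleftrightarrow> comm_eq E w v"
  unfolding comm_class_def by simp

lemma comm_eq_append:
  assumes "comm_eq E v w"
  shows "comm_eq E (x @ v @ y) (x @ w @ y)"
  using assms
proof (induction rule: rtrancl_induct)
  case (step u w)
  then obtain p s s' q where "u = p @ [s, s'] @ q" "w = p @ [s', s] @ q" "{s, s'} \<notin> E"
    unfolding commutations_def by blast
  then have "x @ u @ y = (x @ p) @ [s, s'] @ (q @ y)" "x @ w @ y = (x @ p) @ [s', s] @ (q @ y)"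
    by simp_all
  then have "(x @ u @ y, x @ w @ y) \<in> commutations E"
    using \<open>{s, s'} \<notin> E\<close> unfolding commutations_def by blast
  then show ?case using step.IH by simp
qed simp

text \<open>Deleting letters turns a commutation into a commutation or an equality. Hence
  restriction to a set of letters is well defined on classes.\<close>

lemma comm_eq_filter:
  assumes "comm_eq E v w"
  shows "comm_eq E (filter Q v) (filter Q w)"
  using assms
proof (induction rule: rtrancl_induct)
  case (step u w)
  then obtain p s s' q where uw: "u = p @ [s, s'] @ q" "w = p @ [s', s] @ q" "{s, s'} \<notin> E"
    unfolding commutations_def by blast
  have "(filter Q u, filter Q w) \<in> (commutations E)\<^sup>="
  proof (cases "Q s \<and> Q s'")
    case True
    then have "filter Q u = filter Q p @ [s, s'] @ filter Q q"
      "filter Q w = filter Q p @ [s', s] @ filter Q q" unfolding uw by simp_all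
    then show ?thesis using uw(3) unfolding commutations_def by blast
  next
    case False
    then show ?thesis unfolding uw by auto
  qed
  then show ?case using step.IH by auto
qed simp

lemma comm_eq_set_distinct:
  assumes "comm_eq E v w"
  shows "set w = set v" "distinct w \<longleftrightarrow> distinct v"
proof -
  have "set w = set v \<and> (distinct w \<longleftrightarrow> distinct v)"
    using assms
  proof (induction rule: rtrancl_induct)
    case (step u w)
    then obtain p s s' q where "u = p @ [s, s'] @ q" "w = p @ [s', s] @ q"
      unfolding commutations_def by blast
    then have "set w = set u" "distinct w \<longleftrightarrow> distinct u" by auto
    then show ?case using step.IH by simp
  qed simp
  then show "set w = set v" "distinct w \<longleftrightarrow> distinct v" by simp_all
qed

lemma comm_eq_move: "\<forall>z\<in>set q. {z, b} \<notin> E \<Longrightarrow> comm_eq E (q @ [b]) (b # q)"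
proof (induction q)
  case (Cons z q)
  then have "comm_eq E ([z] @ (q @ [b]) @ []) ([z] @ (b # q) @ [])"
    by (intro comm_eq_append) simp
  moreover have "([] @ [z, b] @ q, [] @ [b, z] @ q) \<in> commutations E"
    using Cons.prems unfolding commutations_def by fastforce
  ultimately show ?case by simp
qed simp

lemma comm_eq_move': "\<forall>z\<in>set q. {z, b} \<notin> E \<Longrightarrow> comm_eq E (x @ q @ b # y) (x @ b # q @ y)"
  using comm_eq_append[OF comm_eq_move, of q b E x y] by simp

text \<open>No commutation applies to two letters joined by an edge, so a class remembers their
  relative order.\<close>

lemma comm_eq_edge:
  assumes "{a, b} \<in> E" "comm_eq E [a, b] w"
  shows "w = [a, b]"
  using assms(2)
proof (induction rule: rtrancl_induct)
  case (step u w)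
  then obtain p s s' q where "u = p @ [s, s'] @ q" "{s, s'} \<notin> E"
    unfolding commutations_def by blast
  moreover from this step.IH have "s = a" "s' = b" by (auto simp: Cons_eq_append_conv)
  ultimately show ?case using assms(1) by simp
qed simp

text \<open>The face order can be tested on arbitrary representatives: a subword of an equivalent of
  \<open>w\<close> is a filter of it, and \<open>comm_eq_filter\<close> carries this filter back to
  \<open>w\<close>.\<close>

lemma class_le_iff:
  assumes "distinct w"
  shows "class_le (comm_class E v) (comm_class E w) \<longleftrightarrow> comm_eq E v (filter (\<lambda>x. x \<in> set v) w)"
proof
  assume "class_le (comm_class E v) (comm_class E w)"
  then obtain v' w' where "v' \<in> comm_class E v" "w' \<in> comm_class E w" and vw: "subseq v' w'"
    unfolding class_le_def by blast
  then have vw: "comm_eq E v v'" "comm_eq E w w'" "subseq v' w'"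
    by (simp_all add: in_comm_class_iff)
  have "distinct w'" "set v' = set v" 
    using comm_eq_set_distinct(2)[OF vw(2)] comm_eq_set_distinct(1)[OF vw(1)] assms by simp_all
  then have "v' = filter (\<lambda>x. x \<in> set v) w'" using subseq_eq_filter[OF vw(3)] by simp
  moreover have "comm_eq E (filter (\<lambda>x. x \<in> set v) w') (filter (\<lambda>x. x \<in> set v) w)"
    by (rule comm_eq_filter[OF comm_eq_sym[OF vw(2)]])
  ultimately show "comm_eq E v (filter (\<lambda>x. x \<in> set v) w)" 
    using comm_eq_trans[OF vw(1)] by simp
next
  assume "comm_eq E v (filter (\<lambda>x. x \<in> set v) w)"
  then show "class_le (comm_class E v) (comm_class E w)"
    unfolding class_le_def
    by (intro bexI[of _ "filter (\<lambda>x. x \<in> set v) w"] bexI[of _ w]) (simp_all add: in_comm_class_iff)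
qed

text \<open>Let \<open>b\<close> replace \<open>a\<close> at the first difference. If
  \<open>b\<close> is in \<open>v\<close>, minimality of \<open>w\<close> in its class yields a
  neighbour of \<open>b\<close> between \<open>a\<close> and \<open>b\<close>; the last such letter
  \<open>z\<close> is outside \<open>v\<close> and is the one to omit. The new word need not be
  equivalent to \<open>w\<close>, only become so after omitting the letter.\<close>

lemma comm_exchange:
  fixes f :: "'a \<Rightarrow> nat"
  assumes d: "distinct w" "distinct w'" and sets: "set w' = set w" and inj: "inj_on f (set w)"
    and least: "\<And>w'. comm_eq E w w' \<Longrightarrow> \<not> map f w' < map f w"
    and less: "map f w' < map f w"
    and v: "comm_eq E v (filter (\<lambda>x. x \<in> set v) w)" "comm_eq E v (filter (\<lambda>x. x \<in> set v) w')"
  obtains x w'' where "x \<in> set w - set v" "distinct w''" "set w'' = set w"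
    "map f w'' < map f w" "comm_eq E (filter (\<lambda>y. y \<noteq> x) w) (filter (\<lambda>y. y \<noteq> x) w'')"
proof -
  obtain u a y b q q' where dec: "w = u @ a # y @ b # q" "w' = u @ b # q'" "f b < f a"
    using map_less_decomp[OF less d sets inj] .
  show ?thesis
  proof (cases "b \<in> set v")
    case False
    let ?w = "u @ b # a # y @ q"
    show ?thesis
    proof (rule that[of b ?w])
      show "b \<in> set w - set v" using False dec by simp
      show "distinct ?w" using d unfolding dec by auto
      show "set ?w = set w" unfolding dec by auto
      show "map f ?w < map f w" unfolding dec using dec(3) by (rule map_less_append)
      show "comm_eq E (filter (\<lambda>y. y \<noteq> b) w) (filter (\<lambda>y. y \<noteq> b) ?w)" unfolding dec by simp
    qed
  next
    case True
    \<comment> \<open>Otherwise \<open>b\<close> could commute past all of \<open>a # y\<close>,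
      giving a smaller word equivalent to \<open>w\<close>.\<close>
    have "\<exists>z\<in>set (a # y). {z, b} \<in> E"
    proof (rule ccontr)
      assume "\<not> ?thesis"
      then have "comm_eq E (u @ (a # y) @ b # q) (u @ b # (a # y) @ q)"
        by (intro comm_eq_move') blast
      moreover have "map f (u @ b # (a # y) @ q) < map f w"
        unfolding dec using dec(3) by (rule map_less_append)
      ultimately show False using least[of "u @ b # (a # y) @ q"] unfolding dec by simp
    qed
    then obtain p z r where z: "a # y = p @ z # r" "{z, b} \<in> E" "\<forall>t\<in>set r. {t, b} \<notin> E"
      using split_list_last_prop[of "a # y" "\<lambda>z. {z, b} \<in> E"] by blast
    have w: "w = (u @ p) @ z # r @ b # q" using z(1) unfolding dec
      by (metis append.assoc append_Cons)
    \<comment> \<open>\<open>w\<close> has \<open>z\<close> before \<open>b\<close>,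
      \<open>w'\<close> has \<open>b\<close> before \<open>z\<close>, and the edge between them
      would fix this order in the class of \<open>v\<close>.\<close>
    have "z \<notin> set v"
    proof
      assume "z \<in> set v"
      define R where "R = (\<lambda>x. x = z \<or> x = b)"
      have "filter R w = [z, b]" using filter_pair d(1) unfolding R_def w by metis
      moreover have "z \<in> set q'" using sets d unfolding w unfolding dec(2) by auto
      then obtain r1 r2 where "q' = r1 @ z # r2" using split_list by metis
      then have "filter R w' = [b, z]"
        using filter_pair[of u b r1 z r2] d(2) unfolding R_def dec by (simp add: disj_commute)
      moreover have "comm_eq E (filter R w) (filter R w')"
      proof -
        have "filter R (filter (\<lambda>x. x \<in> set v) l) = filter R l" for l
          using True \<open>z \<in> set v\<close> unfolding R_def filter_filter by (intro filter_cong) auto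
        moreover have "comm_eq E (filter (\<lambda>x. x \<in> set v) w) (filter (\<lambda>x. x \<in> set v) w')"
          using comm_eq_trans[OF comm_eq_sym[OF v(1)] v(2)] .
        ultimately show ?thesis by (metis comm_eq_filter)
      qed
      moreover have "z \<noteq> b" using d unfolding w by auto
      ultimately show False using comm_eq_edge[OF z(2), of "[b, z]"] by simp
    qed
    then have zw: "z \<in> set w - set v" unfolding w by simp
    show ?thesis
    \<comment> \<open>A small \<open>z\<close> is moved in front of \<open>a\<close>. Otherwise
      \<open>b\<close> is moved in front of \<open>z\<close>, where its label is smaller; once
      \<open>z\<close> is omitted, \<open>b\<close> has only passed the letters of \<open>r\<close>,
      which commute with it.\<close>
    proof (cases "f z < f a")
      case True
      then obtain p' where p': "p = a # p'" using z(1) by (cases p) auto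
      let ?w = "u @ z # p @ r @ b # q"
      show ?thesis
      proof (rule that[OF zw, of ?w])
        show "distinct ?w" using d unfolding w by auto
        show "set ?w = set w" unfolding w by auto
        show "map f ?w < map f w"
          using map_less_append[of f z a u "p @ r @ b # q" "p' @ z # r @ b # q", OF True]
          unfolding w p' by simp
        show "comm_eq E (filter (\<lambda>y. y \<noteq> z) w) (filter (\<lambda>y. y \<noteq> z) ?w)" unfolding w by simp
      qed
    next
      case False
      let ?w = "(u @ p) @ b # z # r @ q"
      have bz: "b \<noteq> z" using d unfolding w by auto
      have move: "comm_eq E (filter (\<lambda>y. y \<noteq> z) ((u @ p @ [z]) @ r @ b # q))
          (filter (\<lambda>y. y \<noteq> z) ((u @ p @ [z]) @ b # r @ q))"
        using z(3) by (intro comm_eq_filter comm_eq_move')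
      show ?thesis
      proof (rule that[OF zw, of ?w])
        show "distinct ?w" using d unfolding w by auto
        show "set ?w = set w" unfolding w by auto
        show "map f ?w < map f w"
          unfolding w using False dec(3) by (intro map_less_append) simp
        show "comm_eq E (filter (\<lambda>y. y \<noteq> z) w) (filter (\<lambda>y. y \<noteq> z) ?w)"
          using move bz unfolding w by simp
      qed
    qed
  qed
qed

text \<open>Equivalent words share their letters, so the union expresses the content without
  choosing a representative.\<close>

lemma comm_class_content: "\<Union> (set ` comm_class E w) = set w"
proof -
  have "set v = set w" if "v \<in> comm_class E w" for v
    using that comm_eq_set_distinct(1)[of w v E] unfolding in_comm_class_iff by simp
  moreover have "w \<in> comm_class E w" by (simp add: in_comm_class_iff)
  ultimately show ?thesis by blast
qed

lemma shellable_comm_classes: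
  fixes S :: "'a set"
  assumes S: "finite S" and \<Delta>: "simplicial_complex S \<Delta>" "shellable (\<subseteq>) \<Delta>"
  shows "shellable class_le (comm_classes \<Delta> E)"
proof -
  obtain f :: "'a \<Rightarrow> nat" where f: "inj_on f S"
    using finite_imp_inj_to_nat_seg[OF S] by blast
  let ?C = "comm_class E" and ?G = "comm_classes (Pow S) E" and ?c = "\<lambda>X. \<Union> (set ` X)"
  \<comment> \<open>A class is ranked by the least label word among its members.\<close>
  let ?k = "\<lambda>X. Min (map f ` X)"
  have G: "?C w \<in> ?G" if "distinct w" "set w \<subseteq> S" for w
    using that unfolding comm_classes_def inj_words_def by blast
  have G_E: thesis if "X \<in> ?G" "\<And>w. X = ?C w \<Longrightarrow> distinct w \<Longrightarrow> set w \<subseteq> S \<Longrightarrow> thesis" for X thesis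
    using that unfolding comm_classes_def inj_words_def by blast
  have fin: "finite (?C w)" if "distinct w" for w
  proof (rule finite_subset)
    show "?C w \<subseteq> {v. set v \<subseteq> set w \<and> distinct v}"
    proof
      fix v assume "v \<in> ?C w"
      then show "v \<in> {v. set v \<subseteq> set w \<and> distinct v}"
        using comm_eq_set_distinct[of w v E] that unfolding in_comm_class_iff by simp
    qed
    show "finite {v. set v \<subseteq> set w \<and> distinct v}" using finite_subset_distinct by blast
  qed
  have k_le: "?k (?C w) \<le> map f w" if "distinct w" for w
    using fin[OF that] by (simp add: in_comm_class_iff)
  have G_min: thesis if XG: "X \<in> ?G"
    and min: "\<And>w. X = ?C w \<Longrightarrow> distinct w \<Longrightarrow> set w \<subseteq> S \<Longrightarrow> ?k X = map f w \<Longrightarrow> thesis" for X thesis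
  proof -
    obtain v where v: "X = ?C v" "distinct v" "set v \<subseteq> S" using G_E[OF XG] by metis
    have "?k X \<in> map f ` X"
      using fin[OF v(2)] unfolding v(1) by (intro Min_in) (auto simp: in_comm_class_iff)
    then obtain w where w: "w \<in> X" "?k X = map f w" by blast
    then have vw: "comm_eq E v w" unfolding v(1) in_comm_class_iff by simp
    then have "X = ?C w" unfolding v(1) by (simp add: comm_class_eq_iff)
    then show thesis using min[of w] w(2) comm_eq_set_distinct[OF vw] v by simp
  qed
  interpret ranked_complex class_le ?G ?c S ?k
  proof
    have "?G \<subseteq> ?C ` {w. set w \<subseteq> S \<and> distinct w}"
      unfolding comm_classes_def inj_words_def by blast
    then show "finite ?G" using finite_subset_distinct[OF S] finite_surj by blast
    show "finite S" by (fact S)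
    show "?c X \<subseteq> S" if "X \<in> ?G" for X
      using that by (rule G_E) (simp only: comm_class_content)
    show "class_le X X" if "X \<in> ?G" for X
      using that by (rule G_E) (simp add: class_le_iff)
    have restrict: "class_le X Y" if G: "X \<in> ?G" "Y \<in> ?G" "Z \<in> ?G"
      and le: "class_le X Z" "class_le Y Z" "?c X \<subseteq> ?c Y" for X Y Z
    proof -
      obtain x y z where xyz: "X = ?C x" "Y = ?C y" "Z = ?C z" "distinct x" "distinct y" "distinct z"
        using G G_E by metis
      have xy: "set x \<subseteq> set y" using le(3) unfolding xyz comm_class_content .
      have 1: "comm_eq E x (filter (\<lambda>a. a \<in> set x) z)"
        and 2: "comm_eq E y (filter (\<lambda>a. a \<in> set y) z)"
        using le(1,2) xyz by (simp_all add: class_le_iff)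
      have "comm_eq E x (filter (\<lambda>a. a \<in> set x) y)"
        using comm_eq_trans[OF 1] comm_eq_filter[OF comm_eq_sym[OF 2], of "\<lambda>a. a \<in> set x"]
        unfolding filter_filter_subset[OF xy] by simp
      then show ?thesis using xyz by (simp add: class_le_iff)
    qed
    then show "class_le X Y" if "X \<in> ?G" "Y \<in> ?G" "Z \<in> ?G" "class_le X Z" "class_le Y Z"
      "?c X \<subseteq> ?c Y" for X Y Z using that by blast
    show mono: "?c X \<subseteq> ?c Y" if G: "X \<in> ?G" "Y \<in> ?G" and le: "class_le X Y" for X Y
    proof -
      obtain x y where xy: "X = ?C x" "Y = ?C y" "distinct y" using G G_E by metis
      then have "comm_eq E x (filter (\<lambda>a. a \<in> set x) y)" using le by (simp add: class_le_iff)
      then have "set x \<subseteq> set y" using comm_eq_set_distinct(1) by fastforce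
      then show ?thesis unfolding xy comm_class_content .
    qed
    show "class_le X Z" if G: "X \<in> ?G" "Y \<in> ?G" "Z \<in> ?G" and le: "class_le X Y" "class_le Y Z"
      for X Y Z
    proof -
      obtain x y z where xyz: "X = ?C x" "Y = ?C y" "Z = ?C z" "distinct x" "distinct y" "distinct z"
        using G G_E by metis
      have xy: "set x \<subseteq> set y" using mono[OF G(1,2) le(1)] unfolding xyz comm_class_content .
      have 1: "comm_eq E x (filter (\<lambda>a. a \<in> set x) y)"
        and 2: "comm_eq E y (filter (\<lambda>a. a \<in> set y) z)"
        using le xyz by (simp_all add: class_le_iff)
      have "comm_eq E x (filter (\<lambda>a. a \<in> set x) z)"
        using comm_eq_trans[OF 1 comm_eq_filter[OF 2]] unfolding filter_filter_subset[OF xy] .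
      then show ?thesis using xyz by (simp add: class_le_iff)
    qed
    show "X = Y" if G: "X \<in> ?G" "Y \<in> ?G" and le: "class_le X Y" "class_le Y X" for X Y
    proof -
      obtain x y where xy: "X = ?C x" "Y = ?C y" "distinct y" using G G_E by metis
      have "set y \<subseteq> set x" using mono[OF G(2,1) le(2)] unfolding xy comm_class_content .
      then have "filter (\<lambda>a. a \<in> set x) y = y" by (intro filter_True) blast
      moreover have "comm_eq E x (filter (\<lambda>a. a \<in> set x) y)"
        using le(1) xy by (simp add: class_le_iff)
      ultimately show ?thesis unfolding xy comm_class_eq_iff by simp
    qed
    show "\<exists>Y\<in>?G. class_le Y X \<and> ?c Y = A" if X: "X \<in> ?G" "A \<subseteq> ?c X" for X A
    proof -
      obtain x where x: "X = ?C x" "distinct x" "set x \<subseteq> S" using X G_E by metis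
      let ?y = "filter (\<lambda>a. a \<in> A) x"
      have A: "A \<subseteq> set x" using X(2) unfolding x comm_class_content .
      then have y: "set ?y = A" by auto
      have "?C ?y \<in> ?G" using x by (intro G) auto
      moreover have "class_le (?C ?y) X" unfolding x(1) class_le_iff[OF x(2)] y by simp
      moreover have "?c (?C ?y) = A" unfolding comm_class_content y ..
      ultimately show ?thesis by blast
    qed
    show "\<exists>Y\<in>?G. class_le X Y \<and> ?c Y = F" if X: "X \<in> ?G" "?c X \<subseteq> F" "F \<subseteq> S" for X F
    proof -
      obtain x where x: "X = ?C x" "distinct x" "set x \<subseteq> S" using X G_E by metis
      have xF: "set x \<subseteq> F" using X(2) unfolding x comm_class_content .
      have "finite (F - set x)" using X S finite_subset by blast
      then obtain t where t: "set t = F - set x" "distinct t" using finite_distinct_list by metis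
      let ?y = "x @ t"
      have y: "set ?y = F" "distinct ?y" using t xF x by auto
      have "?C ?y \<in> ?G" using y X by (intro G) auto
      moreover have "filter (\<lambda>a. a \<in> set x) ?y = x" using t by (simp add: filter_empty_conv)
      then have "class_le X (?C ?y)" unfolding x(1) class_le_iff[OF y(2)] by simp
      moreover have "?c (?C ?y) = F" unfolding comm_class_content y ..
      ultimately show ?thesis by blast
    qed
    have "?C [] \<in> ?G" by (intro G) auto
    then show "?G \<noteq> {}" by blast
    show "class_le X Y" if XY: "X \<in> ?G" "Y \<in> ?G" "?c X = {}" for X Y
    proof -
      obtain x y where xy: "X = ?C x" "Y = ?C y" "distinct y" using XY G_E by metis
      have "set x = {}" using XY(3) unfolding xy comm_class_content .
      then show ?thesis unfolding xy class_le_iff[OF xy(3)] by simp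
    qed
    show "X = Y" if XY: "X \<in> ?G" "Y \<in> ?G" "?c X = ?c Y" "?k X = ?k Y" for X Y
    proof -
      obtain x where x: "X = ?C x" "set x \<subseteq> S" "?k X = map f x" using XY G_min by metis
      obtain y where y: "Y = ?C y" "set y \<subseteq> S" "?k Y = map f y" using XY G_min by metis
      have "inj_on f (set x \<union> set y)" using f x(2) y(2) by (meson Un_least inj_on_subset)
      then have "x = y" using x(3) y(3) XY(4) map_inj_on by metis
      then show ?thesis using x y by simp
    qed
    fix X X' V
    assume X: "X \<in> ?G" "X' \<in> ?G" "?c X' = ?c X" "?k X' < ?k X" and V: "V \<in> ?G"
      "class_le V X" "class_le V X'"
    obtain w where w: "X = ?C w" "distinct w" "set w \<subseteq> S" "?k X = map f w"
      using X(1) G_min by metis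
    obtain w' where w': "X' = ?C w'" "distinct w'" "?k X' = map f w'"
      using X(2) G_min by metis
    obtain v where v: "V = ?C v" using V(1) G_E by metis
    have sets: "set w' = set w" using X(3) unfolding w(1) w'(1) comm_class_content .
    have inj: "inj_on f (set w)" using f w(3) inj_on_subset by blast
    \<comment> \<open>The representative \<open>w\<close> attains the minimum defining the rank of
      \<open>X\<close>, so no equivalent word is smaller.\<close>
    have least: "\<not> map f u < map f w" if "comm_eq E w u" for u
    proof -
      have "distinct u" "X = ?C u" using that comm_eq_set_distinct(2)[OF that] w by (simp_all add: comm_class_eq_iff)
      then show ?thesis using k_le[of u] w(4) by simp
    qed
    have less: "map f w' < map f w" using X(4) w(4) w'(3) by simp
    have "comm_eq E v (filter (\<lambda>x. x \<in> set v) w)" "comm_eq E v (filter (\<lambda>x. x \<in> set v) w')"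
      using V(2,3) unfolding v w(1) w'(1) class_le_iff[OF w(2)] class_le_iff[OF w'(2)] .
    from comm_exchange[OF w(2) w'(2) sets inj least less this]
    obtain x w'' where x: "x \<in> set w - set v" and w'': "distinct w''" "set w'' = set w"
      "map f w'' < map f w"
      and fil: "comm_eq E (filter (\<lambda>y. y \<noteq> x) w) (filter (\<lambda>y. y \<noteq> x) w'')" .
    let ?u = "filter (\<lambda>y. y \<noteq> x) w"
    have u: "y \<in> set ?u \<longleftrightarrow> y \<in> set w \<and> y \<noteq> x" for y by auto
    have "?C ?u \<in> ?G" "?C w'' \<in> ?G" using w w'' by (auto intro!: G)
    moreover have "class_le (?C ?u) X"
      unfolding w(1) class_le_iff[OF w(2)] u by (simp cong: filter_cong)
    moreover have "class_le (?C ?u) (?C w'')"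
      using fil unfolding class_le_iff[OF w''(1)] u w''(2)[symmetric] by (simp cong: filter_cong)
    \<comment> \<open>\<open>w''\<close> may fail to be least in its class, but it bounds the rank
      from above.\<close>
    moreover have "?k (?C w'') < ?k X" using k_le[OF w''(1)] w''(3) w(4) by simp
    moreover have "?c (?C ?u) = set w - {x}" unfolding comm_class_content by auto
    moreover have "?c X = set w" "?c V = set v" "?c (?C w'') = set w"
      unfolding w(1) v comm_class_content using w''(2) by simp_all
    ultimately show "\<exists>x\<in>?c X - ?c V. \<exists>X''\<in>?G. ?c X'' = ?c X \<and> ?k X'' < ?k X \<and>
        (\<exists>U\<in>?G. class_le U X \<and> class_le U X'' \<and> ?c U = ?c X - {x})"
      using x by metis
  qed
  have "cells_below \<Delta> {} = comm_classes \<Delta> E"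
  proof (rule set_eqI)
    fix X
    have "X \<in> cells_below \<Delta> {} \<longleftrightarrow> X \<in> ?G \<and> ?c X \<in> \<Delta>" unfolding cells_below_def by simp
    also have "\<dots> \<longleftrightarrow> (\<exists>w. X = ?C w \<and> distinct w \<and> set w \<subseteq> S \<and> set w \<in> \<Delta>)"
      by (auto simp: comm_classes_def inj_words_def comm_class_content)
    finally have "X \<in> cells_below \<Delta> {} \<longleftrightarrow>
      (\<exists>w. X = ?C w \<and> distinct w \<and> set w \<subseteq> S \<and> set w \<in> \<Delta>)" .
    moreover have "X \<in> comm_classes \<Delta> E \<longleftrightarrow> (\<exists>w. X = ?C w \<and> distinct w \<and> set w \<in> \<Delta>)"
      by (auto simp: comm_classes_def inj_words_def)
    moreover have "set w \<subseteq> S" if "set w \<in> \<Delta>" for w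
      using that \<Delta>(1) unfolding simplicial_complex_def by blast
    ultimately show "X \<in> cells_below \<Delta> {} \<longleftrightarrow> X \<in> comm_classes \<Delta> E" by metis
  qed
  then show ?thesis using shellable_over[OF \<Delta>(2,1)] by simp
qed

theorem theorem1p2:
  fixes S :: "'a set" and \<Delta> :: "'a set set"
  assumes "finite S"
    and "simplicial_complex S \<Delta>"
    and "shellable (\<subseteq>) \<Delta>"
  shows "(\<forall>P. partial_order_on S P \<longrightarrow> shellable subseq (poset_words \<Delta> P)) \<and>
         (\<forall>E. simple_graph S E \<longrightarrow> shellable class_le (comm_classes \<Delta> E))"
  using shellable_poset_words[OF assms] shellable_comm_classes[OF assms]
  unfolding partial_order_on_def preorder_on_def by blast

end
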